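(* Let $B=B(F_n)$ be a generalized Bratteli diagram and $\overline B=B(\overline F)$ a stationary vertex subdiagram of $B$ supported at every level by a fixed vertex set $W$. Let $(\lambda,\xi)$ be an eigenpair with $\overline F^{T}\xi=\lambda\xi$, $1<\lambda<\infty$, $\xi=(\xi_v)_{v\in W}$ positive, $\sum_{v\in W}\xi_v=1$, and let $\nu$ be the corresponding probability tail invariant measure on $X_{\overline B}$, giving measure $\xi_v/\lambda^n$ to every cylinder set of $X_{\overline B}$ determined by a finite path from level $0$ to $v\in W$ at level $n$. With $\alpha_n=\sum_{w\in W'_n}H^{(n)}_w$ and $W'_n,M'_n,m'_n$ as defined in the context: \begin{enumerate} \item If for every $\varepsilon>0$ there exists $N_\varepsilon\in\mathbb N$ such that, for all $n\ge N_\varepsilon$, $\alpha_{n+1}M'_{n+1}<(\lambda-\varepsilon)\alpha_nM'_n$, then $\widehat\nu(\widehat X_{\overline B})<\infty$. \item If for every $\varepsilon>0$ there exists $N_\varepsilon\in\mathbb N$ such that, for all $n\ge N_\varepsilon$, $\alpha_{n+1}m'_{n+1}>(\lambda+\varepsilon)\alpha_nm'_n$, then $\widehat\nu(\widehat X_{\overline B})=\infty$. \end{enumerate}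
   Context: A generalized Bratteli diagram is a graded graph $B=(V,E)$, $V=\bigsqcup_{n\ge0}V_n$, $E=\bigsqcup_{n\ge0}E_n$, with each $V_n$ countably infinite and each $E_n$ countable; every $e\in E_n$ has a source $s(e)\in V_n$ and a range $r(e)\in V_{n+1}$; $s^{-1}(v)\ne\emptyset$ for all $v\in V$; $r^{-1}(v)$ is nonempty and finite for all $v\in V\setminus V_0$. The incidence matrix $F_n=(f^{(n)}_{v,w})_{v\in V_{n+1},w\in V_n}$ counts the edges between $w$ and $v$. The path space $X_B$ is the set of infinite sequences $(x_n)$, $x_n\in E_n$, $r(x_n)=s(x_{n+1})$, with the topology generated by cylinder sets of finite paths starting in $V_0$. Two paths are tail equivalent (relation $\mathcal R$) if they agree from some index on. A tail invariant measure is a non-atomic positive Borel measure giving equal value to cylinder sets $[\overline e]$, $[\overline e']$ whenever $\overline e,\overline e'$ are finite paths from $V_0$ to the same vertex. The height $H^{(n)}_w$ is the number of finite paths in $B$ from $V_0$ to $w\in V_n$ ($H^{(0)}_w=1$). Stationary vertex subdiagram: all $V_n$ are identified with one set, $W$ is a fixed proper subset (finite or infinite), and the restriction of every $F_n$ to $W\times W$ equals the same matrix $\overline F$; $\overline B$ has vertex set $W$ at each level and all edges of $B$ between vertices of $W$; it is assumed to be itself a Bratteli diagram. The diagram $B$ itself need not be stationary. Notation: $W'_n$ is the set of $w\in V_n\setminus W$ that are joined by an edge to some vertex of $W\subset V_{n+1}$; $M'_n=\max\{f^{(n)}_{v,w}:v\in W,w\in W'_n\}$, $m'_n=\min\{f^{(n)}_{v,w}:v\in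 W,w\in W'_n\}$. The numbers $\alpha_n$ and $M'_n$ are assumed finite. Measure extension: $\widehat X_{\overline B}\subset X_B$ is the set of all paths of $X_B$ tail equivalent (in $B$) to some path of $X_{\overline B}$; $\widehat\nu$ is the $\mathcal R$-invariant Borel measure (possibly infinite) on $\widehat X_{\overline B}$ extending $\nu$: for a finite path $f$ of $B$ from $V_0$ to $v\in W$ at level $n$, the set of paths that begin with $f$ and whose edges after $f$ all lie in $\overline B$ has $\widehat\nu$-measure $\xi_v/\lambda^n$. *)

theory Defs
  imports "HOL-Probability.Probability"
begin

text \<open>
  The level of a vertex or an edge is kept as a separate index: the vertex set of the graph is the
  disjoint union of the sets \<open>verts B n\<close>, and its edge set that of the sets \<open>edges B n\<close>. Hence the same
  element of type \<open>'v\<close> may occur at every level, which is how the levels of a stationary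
  (sub)diagram are identified with one set.
\<close>

record ('v, 'e) graded_graph =
  verts :: "nat \<Rightarrow> 'v set"
  edges :: "nat \<Rightarrow> 'e set"
  src :: "nat \<Rightarrow> 'e \<Rightarrow> 'v"
  rng :: "nat \<Rightarrow> 'e \<Rightarrow> 'v"

text \<open>
  Levels may be finite here, so that this also covers (sub)diagrams on a finite vertex set.
\<close>

locale bratteli_diagram =
  fixes B :: "('v, 'e) graded_graph"
  assumes verts_nonempty: "verts B n \<noteq> {}"
    and countable_verts: "countable (verts B n)"
    and countable_edges: "countable (edges B n)"
    and src_in_verts: "e \<in> edges B n \<Longrightarrow> src B n e \<in> verts B n"
    and rng_in_verts: "e \<in> edges B n \<Longrightarrow> rng B n e \<in> verts B (Suc n)"
    and outgoing_nonempty: "v \<in> verts B n \<Longrightarrow> {e \<in> edges B n. src B n e = v} \<noteq> {}"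
    and incoming_nonempty: "v \<in> verts B (Suc n) \<Longrightarrow> {e \<in> edges B n. rng B n e = v} \<noteq> {}"
    and incoming_finite: "v \<in> verts B (Suc n) \<Longrightarrow> finite {e \<in> edges B n. rng B n e = v}"

locale generalized_bratteli_diagram = bratteli_diagram +
  assumes infinite_verts: "infinite (verts B n)"

definition incidence :: "('v, 'e) graded_graph \<Rightarrow> nat \<Rightarrow> 'v \<Rightarrow> 'v \<Rightarrow> nat" where
  "incidence B n v w = card {e \<in> edges B n. src B n e = w \<and> rng B n e = v}"

text \<open>
  \<open>walk B n v es w\<close>: the edge list \<open>es\<close> is a path from \<open>v\<close> at level \<open>n\<close> to \<open>w\<close> at level \<open>n + length es\<close>.
\<close>

fun walk :: "('v, 'e) graded_graph \<Rightarrow> nat \<Rightarrow> 'v \<Rightarrow> 'e list \<Rightarrow> 'v \<Rightarrow> bool" where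
  "walk B n v [] w \<longleftrightarrow> v \<in> verts B n \<and> v = w"
| "walk B n v (e # es) w \<longleftrightarrow> e \<in> edges B n \<and> src B n e = v \<and> walk B (Suc n) (rng B n e) es w"

text \<open>
  Finite paths from level \<open>0\<close> to \<open>w\<close> at level \<open>n\<close>. The initial vertex is recorded so that the paths of
  length \<open>0\<close> are the vertices of level \<open>0\<close>.
\<close>

definition paths_to :: "('v, 'e) graded_graph \<Rightarrow> nat \<Rightarrow> 'v \<Rightarrow> ('v \<times> 'e list) set" where
  "paths_to B n w = {(v, es). length es = n \<and> walk B 0 v es w}"

definition height :: "('v, 'e) graded_graph \<Rightarrow> nat \<Rightarrow> 'v \<Rightarrow> nat" where
  "height B n w = card (paths_to B n w)"

definition path_space :: "('v, 'e) graded_graph \<Rightarrow> (nat \<Rightarrow> 'e) set" where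
  "path_space B = {x. \<forall>n. x n \<in> edges B n \<and> rng B n (x n) = src B (Suc n) (x (Suc n))}"

definition cylinder :: "('v, 'e) graded_graph \<Rightarrow> 'v \<times> 'e list \<Rightarrow> (nat \<Rightarrow> 'e) set" where
  "cylinder B p = {x \<in> path_space B. src B 0 (x 0) = fst p \<and> (\<forall>i < length (snd p). x i = snd p ! i)}"

definition path_topology :: "('v, 'e) graded_graph \<Rightarrow> (nat \<Rightarrow> 'e) topology" where
  "path_topology B = topology_generated_by {cylinder B p | n w p. w \<in> verts B n \<and> p \<in> paths_to B n w}"

definition path_borel :: "('v, 'e) graded_graph \<Rightarrow> (nat \<Rightarrow> 'e) measure" where
  "path_borel B = sigma (path_space B) {U. openin (path_topology B) U}"

definition tail_equivalent :: "(nat \<Rightarrow> 'e) \<Rightarrow> (nat \<Rightarrow> 'e) \<Rightarrow> bool" where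
  "tail_equivalent x y \<longleftrightarrow> (\<exists>m. \<forall>n\<ge>m. x n = y n)"

definition non_atomic :: "'a measure \<Rightarrow> bool" where
  "non_atomic M \<longleftrightarrow>
     (\<forall>A \<in> sets M. 0 < emeasure M A \<longrightarrow>
        (\<exists>C \<in> sets M. C \<subseteq> A \<and> 0 < emeasure M C \<and> emeasure M C < emeasure M A))"

text \<open>
  Tail invariant measures on a set \<open>Y\<close> of paths that is closed under tail equivalence, such as the
  whole path space. The value \<open>\<infinity>\<close> is allowed.
\<close>

definition tail_invariant_measure ::
    "('v, 'e) graded_graph \<Rightarrow> (nat \<Rightarrow> 'e) set \<Rightarrow> (nat \<Rightarrow> 'e) measure \<Rightarrow> bool" where
  "tail_invariant_measure B Y M \<longleftrightarrow>
     sets M = sets (restrict_space (path_borel B) Y) \<and> non_atomic M \<and>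
     (\<forall>n. \<forall>w \<in> verts B n. \<forall>p \<in> paths_to B n w. \<forall>q \<in> paths_to B n w.
        emeasure M (cylinder B p \<inter> Y) = emeasure M (cylinder B q \<inter> Y))"

definition vertex_subdiagram :: "('v, 'e) graded_graph \<Rightarrow> 'v set \<Rightarrow> ('v, 'e) graded_graph" where
  "vertex_subdiagram B W =
     B\<lparr>verts := (\<lambda>n. W), edges := (\<lambda>n. {e \<in> edges B n. src B n e \<in> W \<and> rng B n e \<in> W})\<rparr>"

text \<open>The diagram \<open>B\<close> need not be stationary; only its restriction to \<open>W\<close> is.\<close>

locale stationary_vertex_subdiagram = generalized_bratteli_diagram B
  for B :: "('v, 'e) graded_graph" +
  fixes W :: "'v set" and Fbar :: "'v \<Rightarrow> 'v \<Rightarrow> nat"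
  assumes levels_identified: "verts B n = verts B 0"
    and proper_subset: "W \<subset> verts B 0"
    and stationary: "\<lbrakk>v \<in> W; w \<in> W\<rbrakk> \<Longrightarrow> incidence B n v w = Fbar v w"
    and subdiagram: "bratteli_diagram (vertex_subdiagram B W)"

definition outer_nbrs :: "('v, 'e) graded_graph \<Rightarrow> 'v set \<Rightarrow> nat \<Rightarrow> 'v set" where
  "outer_nbrs B W n = {w \<in> verts B n - W. \<exists>e \<in> edges B n. src B n e = w \<and> rng B n e \<in> W}"

definition alpha :: "('v, 'e) graded_graph \<Rightarrow> 'v set \<Rightarrow> nat \<Rightarrow> real" where
  "alpha B W n = (\<Sum>\<^sub>\<infinity>w \<in> outer_nbrs B W n. real (height B n w))"

text \<open>
  Over \<open>nat\<close>, \<open>Sup\<close> of a nonempty bounded set is its maximum and \<open>Inf\<close> of a nonempty set is its minimum.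
  If the set of outer neighbours is empty then \<open>outer_max\<close> and \<open>outer_min\<close> only occur multiplied
  by \<open>alpha = 0\<close>.
\<close>

definition outer_entries :: "('v, 'e) graded_graph \<Rightarrow> 'v set \<Rightarrow> nat \<Rightarrow> nat set" where
  "outer_entries B W n = {incidence B n v w | v w. v \<in> W \<and> w \<in> outer_nbrs B W n}"

definition outer_max :: "('v, 'e) graded_graph \<Rightarrow> 'v set \<Rightarrow> nat \<Rightarrow> nat" where
  "outer_max B W n = Sup (outer_entries B W n)"

definition outer_min :: "('v, 'e) graded_graph \<Rightarrow> 'v set \<Rightarrow> nat \<Rightarrow> nat" where
  "outer_min B W n = Inf (outer_entries B W n)"

definition extension_space :: "('v, 'e) graded_graph \<Rightarrow> 'v set \<Rightarrow> (nat \<Rightarrow> 'e) set" where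
  "extension_space B W =
     {x \<in> path_space B. \<exists>y \<in> path_space (vertex_subdiagram B W). tail_equivalent x y}"

text \<open>
  The sets in the last clause, for all finite paths \<open>p\<close> of \<open>B\<close> ending in \<open>W\<close>, form a countable
  intersection-stable generator of the Borel sets of the extension space and cover it, so that there
  is only one such measure \<open>\<nu>h\<close>.
\<close>

definition measure_extension ::
    "('v, 'e) graded_graph \<Rightarrow> 'v set \<Rightarrow> real \<Rightarrow> ('v \<Rightarrow> real) \<Rightarrow>
     (nat \<Rightarrow> 'e) measure \<Rightarrow> (nat \<Rightarrow> 'e) measure \<Rightarrow> bool" where
  "measure_extension B W l \<xi> \<nu> \<nu>h \<longleftrightarrow>
     tail_invariant_measure B (extension_space B W) \<nu>h \<and>
     (\<forall>A \<in> sets \<nu>. emeasure \<nu>h A = emeasure \<nu> A) \<and>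
     (\<forall>n. \<forall>v \<in> W. \<forall>p \<in> paths_to B n v.
        emeasure \<nu>h {x \<in> cylinder B p. \<forall>i\<ge>n. x i \<in> edges (vertex_subdiagram B W) i}
          = ennreal (\<xi> v / l ^ n))"

end

theory Submission
  imports Defs
begin

text \<open>
  Let \<open>S n\<close> be the \<open>\<nu>h\<close>-measure of the set of paths whose edges from level \<open>n\<close> on lie in the
  subdiagram. These sets increase to the extension space, so its measure is \<open>sup S\<close>. Splitting
  the paths to a vertex \<open>v \<in> W\<close> of level \<open>n\<close> by their cylinders gives
  \<open>S n = (\<Sum>v\<in>W. height n v * \<xi> v / l ^ n)\<close>. The recursion for the heights, split according to
  whether the last edge starts in \<open>W\<close> or in an outer neighbour, and the eigenvector equation give
  \<open>S (n + 1) = S n + (\<Sum>v\<in>W. \<Sum>w outer. f v w * height n w * \<xi> v) / l ^ (n + 1)\<close>. As \<open>\<xi>\<close> has sum \<open>1\<close>,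
  the increment lies between \<open>\<alpha> n * m n / l ^ (n + 1)\<close> and \<open>\<alpha> n * M n / l ^ (n + 1)\<close>, and the two
  hypotheses compare these bounds with a geometric sequence.
\<close>

text \<open>Carries real sums such as the normalisation of \<xi> and the eigenvector equation over
  to \<open>ennreal\<close>, where countable sums are integrals and Tonelli applies. For reals,
  unconditional summability is absolute summability.\<close>

lemma has_sum_nn_integral_count_space:
  fixes f :: "'a \<Rightarrow> real"
  assumes "(f has_sum s) A" "\<And>x. x \<in> A \<Longrightarrow> 0 \<le> f x"
  shows "(\<integral>\<^sup>+x. ennreal (f x) \<partial>count_space A) = ennreal s"
proof -
  have "f summable_on A"
    using assms(1) by (rule has_sum_imp_summable)
  then have abs: "Infinite_Set_Sum.abs_summable_on f A"
    using abs_summable_equivalent summable_on_iff_abs_summable_on_real by blast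
  show ?thesis
    using nn_integral_conv_infsetsum[OF abs] assms infsetsum_infsum[OF abs] infsumI[OF assms(1)]
    by simp
qed

section \<open>Finite paths and heights\<close>

context bratteli_diagram
begin

text \<open>\<open>walk\<close> recurses on the first edge, whereas the height recursion strips the
  last one. In the empty case the required vertex memberships come from the edge \<open>e\<close>
  itself.\<close>

lemma walk_snoc:
  "walk B n v (es @ [e]) w \<longleftrightarrow>
     walk B n v es (src B (n + length es) e) \<and> e \<in> edges B (n + length es) \<and>
     rng B (n + length es) e = w"
proof (induction es arbitrary: n v)
  case Nil
  then show ?case
    using src_in_verts rng_in_verts by auto
next
  case (Cons a es)
  then show ?case by simp
qed

lemma walk_end_unique: "walk B n v es w \<Longrightarrow> walk B n v es w' \<Longrightarrow> w = w'"
  by (induction es arbitrary: n v) auto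

text \<open>Writing the endpoint as the source of the next edge covers \<open>n = 0\<close> and
  shows at once that the endpoint lies in \<open>W\<close> when that next edge belongs to the
  subdiagram.\<close>

lemma walk_path_prefix:
  assumes "x \<in> path_space B"
  shows "walk B 0 (src B 0 (x 0)) (map x [0..<n]) (src B n (x n))"
proof (induction n)
  case 0
  then show ?case
    using assms src_in_verts by (auto simp: path_space_def)
next
  case (Suc n)
  then show ?case
    using assms by (simp add: walk_snoc path_space_def)
qed

lemma paths_to_0: "v \<in> verts B 0 \<Longrightarrow> paths_to B 0 v = {(v, [])}"
  by (auto simp: paths_to_def)

lemma paths_to_Suc:
  "paths_to B (Suc n) v =
     (\<Union>e\<in>{e \<in> edges B n. rng B n e = v}. (\<lambda>(u, es). (u, es @ [e])) ` paths_to B n (src B n e))"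
  (is "?L = ?R")
proof (intro set_eqI iffI)
  fix p assume p: "p \<in> ?L"
  obtain u fs where u: "p = (u, fs)"
    by (cases p)
  with p have "length fs = Suc n"
    by (simp add: paths_to_def)
  then obtain es e where "fs = es @ [e]" "length es = n"
    by (metis length_Suc_conv_rev)
  with p u show "p \<in> ?R"
    by (auto simp: paths_to_def walk_snoc image_iff)
next
  fix p assume "p \<in> ?R"
  then show "p \<in> ?L"
    by (auto simp: paths_to_def walk_snoc)
qed

text \<open>Elements that are not vertices receive no edges; hence the induction in
  \<open>finite_paths_to\<close> can run over arbitrary \<open>v\<close>.\<close>

lemma finite_incoming: "finite {e \<in> edges B n. rng B n e = v}"
proof (cases "v \<in> verts B (Suc n)")
  case True
  then show ?thesis by (rule incoming_finite)
next
  case False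
  then have "{e \<in> edges B n. rng B n e = v} = {}"
    using rng_in_verts by auto
  then show ?thesis by (simp only: finite.emptyI)
qed

lemma finite_paths_to: "finite (paths_to B n v)"
proof (induction n arbitrary: v)
  case 0
  have "paths_to B 0 v \<subseteq> {(v, [])}"
    by (auto simp: paths_to_def)
  then show ?case
    using finite_subset by blast
next
  case (Suc n)
  then show ?case
    unfolding paths_to_Suc by (intro finite_UN_I finite_incoming finite_imageI)
qed

text \<open>Paths with different last edges differ, and appending a fixed edge is injective, so the
  cardinalities in \<open>paths_to_Suc\<close> add up.\<close>

lemma height_Suc:
  "height B (Suc n) v = (\<Sum>e | e \<in> edges B n \<and> rng B n e = v. height B n (src B n e))"
proof -
  have inj: "inj_on (\<lambda>(u, es). (u, es @ [e])) A" for e :: 'b and A :: "('a \<times> 'b list) set"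
    by (auto simp: inj_on_def)
  show ?thesis
    unfolding height_def paths_to_Suc
    by (subst card_UN_disjoint)
      (auto simp: finite_incoming finite_paths_to card_image[OF inj])
qed

text \<open>Incoming edges exist at every vertex, so a tail can be prolonged downwards one level at a time.\<close>

lemma tail_extends_to_path:
  assumes "\<And>i. n \<le> i \<Longrightarrow> x i \<in> edges B i \<and> rng B i (x i) = src B (Suc i) (x (Suc i))"
  shows "\<exists>y \<in> path_space B. \<forall>i\<ge>n. y i = x i"
  using assms
proof (induction n arbitrary: x)
  case 0
  then show ?case
    by (auto simp: path_space_def)
next
  case (Suc n)
  have "src B (Suc n) (x (Suc n)) \<in> verts B (Suc n)"
    using Suc.prems src_in_verts by blast
  then obtain e where e: "e \<in> edges B n" "rng B n e = src B (Suc n) (x (Suc n))"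
    using incoming_nonempty by blast
  \<comment> \<open>The premise does not constrain \<open>x n\<close>, so this entry may be
    overwritten by the incoming edge \<open>e\<close>.\<close>
  have "\<exists>y \<in> path_space B. \<forall>i\<ge>n. y i = (x(n := e)) i"
  proof (rule Suc.IH)
    fix i assume "n \<le> i"
    then show "(x(n := e)) i \<in> edges B i \<and>
        rng B i ((x(n := e)) i) = src B (Suc i) ((x(n := e)) (Suc i))"
      using Suc.prems[of i] e by (cases "i = n") auto
  qed
  then show ?case
    by (metis Suc_leD Suc_n_not_le_n fun_upd_other)
qed

end

section \<open>Paths with tail in the subdiagram\<close>

definition tail_inside :: "('v, 'e) graded_graph \<Rightarrow> 'v set \<Rightarrow> nat \<Rightarrow> (nat \<Rightarrow> 'e) set" where
  "tail_inside B W n = {x \<in> path_space B. \<forall>i\<ge>n. x i \<in> edges (vertex_subdiagram B W) i}"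

lemma vertex_subdiagram_simps [simp]:
  "verts (vertex_subdiagram B W) n = W"
  "edges (vertex_subdiagram B W) n = {e \<in> edges B n. src B n e \<in> W \<and> rng B n e \<in> W}"
  "src (vertex_subdiagram B W) = src B"
  "rng (vertex_subdiagram B W) = rng B"
  by (simp_all add: vertex_subdiagram_def)

context stationary_vertex_subdiagram
begin

sublocale sub: bratteli_diagram "vertex_subdiagram B W"
  by (rule subdiagram)

lemma W_subset_verts: "W \<subseteq> verts B n"
  using proper_subset levels_identified by blast

lemma countable_W: "countable W"
  using W_subset_verts countable_verts countable_subset by blast

text \<open>The nontrivial inclusion starts from a tail inside the subdiagram and prolongs it down
  to level 0 without leaving \<open>W\<close>. This works because the subdiagram is itself a
  Bratteli diagram, so \<open>tail_extends_to_path\<close> applies to it.\<close>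

lemma extension_space_eq_UN: "extension_space B W = (\<Union>n. tail_inside B W n)"
proof (intro set_eqI iffI)
  fix x assume "x \<in> extension_space B W"
  then obtain y m where "x \<in> path_space B" "y \<in> path_space (vertex_subdiagram B W)"
      "\<forall>n\<ge>m. x n = y n"
    by (auto simp: extension_space_def tail_equivalent_def)
  then have "x \<in> tail_inside B W m"
    by (auto simp: tail_inside_def path_space_def)
  then show "x \<in> (\<Union>n. tail_inside B W n)"
    by blast
next
  fix x assume "x \<in> (\<Union>n. tail_inside B W n)"
  then obtain n where x: "x \<in> tail_inside B W n"
    by blast
  then have "\<exists>y \<in> path_space (vertex_subdiagram B W). \<forall>i\<ge>n. y i = x i"
    by (intro sub.tail_extends_to_path) (auto simp: tail_inside_def path_space_def)
  then have "\<exists>y \<in> path_space (vertex_subdiagram B W). tail_equivalent x y"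
    unfolding tail_equivalent_def by metis
  then show "x \<in> extension_space B W"
    using x by (auto simp: extension_space_def tail_inside_def)
qed

text \<open>Paths are sorted by their first \<open>n\<close> edges. The vertex reached is the source
  of \<open>x n\<close>, an edge of the subdiagram, and so lies in \<open>W\<close>.\<close>

lemma tail_inside_eq_UN:
  "tail_inside B W n =
     (\<Union>v\<in>W. \<Union>p\<in>paths_to B n v. {x \<in> cylinder B p. \<forall>i\<ge>n. x i \<in> edges (vertex_subdiagram B W) i})"
proof (intro set_eqI iffI)
  fix x assume x: "x \<in> tail_inside B W n"
  let ?p = "(src B 0 (x 0), map x [0..<n])"
  have xp: "x \<in> path_space B"
    using x by (simp add: tail_inside_def)
  have "?p \<in> paths_to B n (src B n (x n))" "src B n (x n) \<in> W"
    using walk_path_prefix[OF xp, of n] x by (auto simp: paths_to_def tail_inside_def)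
  moreover have "x \<in> {x \<in> cylinder B ?p. \<forall>i\<ge>n. x i \<in> edges (vertex_subdiagram B W) i}"
    using x xp by (auto simp: cylinder_def tail_inside_def)
  ultimately show "x \<in> (\<Union>v\<in>W. \<Union>p\<in>paths_to B n v.
      {x \<in> cylinder B p. \<forall>i\<ge>n. x i \<in> edges (vertex_subdiagram B W) i})"
    by blast
qed (auto simp: tail_inside_def cylinder_def)

text \<open>Gives the disjointness of the pieces in \<open>tail_inside_eq_UN\<close>. Both finite
  paths have length \<open>n\<close>, so they agree edge by edge; for \<open>n = 0\<close> the
  recorded initial vertex separates them.\<close>

lemma cylinder_paths_to_eq:
  assumes "x \<in> cylinder B p" "x \<in> cylinder B q" "p \<in> paths_to B n v" "q \<in> paths_to B n w"
  shows "p = q" "v = w"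
proof -
  have "snd p = snd q"
    using assms by (intro nth_equalityI) (auto simp: paths_to_def cylinder_def)
  moreover have "fst p = fst q"
    using assms by (simp add: cylinder_def)
  ultimately show pq: "p = q"
    by (rule prod_eqI[rotated])
  show "v = w"
    using assms(3,4) unfolding pq by (auto simp: paths_to_def intro: walk_end_unique)
qed

text \<open>Only finitely many terms are nonzero, but integrals over index sets independent of
  \<open>v\<close> are what the later interchange of summation requires.\<close>

lemma height_Suc_split:
  assumes v: "v \<in> W"
  shows "ennreal (height B (Suc n) v) =
     (\<integral>\<^sup>+w. ennreal (Fbar v w * height B n w) \<partial>count_space W) +
     (\<integral>\<^sup>+w. ennreal (incidence B n v w * height B n w) \<partial>count_space (outer_nbrs B W n))"
proof -
  let ?I = "{e \<in> edges B n. rng B n e = v}"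
  let ?g = "\<lambda>w. real (incidence B n v w * height B n w)"
  let ?T = "src B n ` ?I"
  have fin: "finite ?I" "finite ?T"
    using finite_incoming by auto
  have zero: "incidence B n v w = 0" if "w \<notin> ?T" for w
    unfolding incidence_def using that by (intro card_eq_0_iff[THEN iffD2] disjI1) auto
  \<comment> \<open>The edges into \<open>v\<close> are grouped by their source; all edges of one
    group contribute the same height.\<close>
  have "height B (Suc n) v = (\<Sum>w\<in>?T. \<Sum>e | e \<in> ?I \<and> src B n e = w. height B n (src B n e))"
    unfolding height_Suc by (rule sum.group[symmetric]) (use fin in auto)
  also have "\<dots> = (\<Sum>w\<in>?T. incidence B n v w * height B n w)"
    by (intro sum.cong refl) (auto simp: incidence_def conj_ac intro!: arg_cong[where f = card])
  finally have "real (height B (Suc n) v) = (\<Sum>w\<in>?T. ?g w)"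
    by simp
  also have "\<dots> = (\<Sum>w\<in>?T \<inter> W. ?g w) + (\<Sum>w\<in>?T - W. ?g w)"
    using sum.Int_Diff[OF fin(2)] .
  finally have eq: "ennreal (height B (Suc n) v) =
      (\<Sum>w\<in>?T \<inter> W. ennreal (?g w)) + (\<Sum>w\<in>?T - W. ennreal (?g w))"
    by (simp add: sum_nonneg)
  have inner: "(\<integral>\<^sup>+w. ennreal (Fbar v w * height B n w) \<partial>count_space W)
      = (\<Sum>w\<in>?T \<inter> W. ennreal (?g w))"
  proof -
    have "(\<integral>\<^sup>+w. ennreal (Fbar v w * height B n w) \<partial>count_space W)
        = (\<integral>\<^sup>+w. ennreal (?g w) \<partial>count_space W)"
      by (intro nn_integral_cong) (simp add: stationary[OF v])
    also have "\<dots> = (\<Sum>w\<in>?T \<inter> W. ennreal (?g w))"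
      using fin zero by (intro nn_integral_count_space') auto
    finally show ?thesis .
  qed
  have outer: "(\<integral>\<^sup>+w. ennreal (?g w) \<partial>count_space (outer_nbrs B W n))
      = (\<Sum>w\<in>?T - W. ennreal (?g w))"
  proof (rule nn_integral_count_space')
    \<comment> \<open>A source outside \<open>W\<close> of an edge into \<open>v\<close> is an outer
      neighbour because \<open>v\<close> lies in \<open>W\<close>.\<close>
    show "?T - W \<subseteq> outer_nbrs B W n"
      using v src_in_verts by (auto simp: outer_nbrs_def)
    show "ennreal (?g w) = 0" if "w \<in> outer_nbrs B W n" "w \<notin> ?T - W" for w
      using that zero[of w] by (auto simp: outer_nbrs_def)
  qed (use fin in auto)
  show ?thesis
    using eq inner outer by simp
qed

end

section \<open>Measures of the tail sets and their increments\<close>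

locale eigen_extension = stationary_vertex_subdiagram B W Fbar
  for B :: "('v, 'e) graded_graph" and W :: "'v set" and Fbar :: "'v \<Rightarrow> 'v \<Rightarrow> nat" +
  fixes l :: real and \<xi> :: "'v \<Rightarrow> real" and \<nu>h :: "(nat \<Rightarrow> 'e) measure"
  assumes l_gt_1: "1 < l"
    and xi_pos: "v \<in> W \<Longrightarrow> 0 < \<xi> v"
    and xi_sum: "(\<xi> has_sum 1) W"
    and eigenpair: "w \<in> W \<Longrightarrow> ((\<lambda>v. real (Fbar v w) * \<xi> v) has_sum l * \<xi> w) W"
    and extension_cylinder: "\<lbrakk>v \<in> W; p \<in> paths_to B n v\<rbrakk> \<Longrightarrow>
      emeasure \<nu>h {x \<in> cylinder B p. \<forall>i\<ge>n. x i \<in> edges (vertex_subdiagram B W) i}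
        = ennreal (\<xi> v / l ^ n)"
    and alpha_summable: "(\<lambda>w. real (height B n w)) summable_on outer_nbrs B W n"
    and entries_bdd: "bdd_above (outer_entries B W n)"
begin

text \<open>The measure of a non-measurable set is \<open>0\<close> by convention, so the positive values in
  \<open>extension_cylinder\<close> already imply measurability.\<close>

lemma extension_cylinder_sets:
  assumes "v \<in> W" "p \<in> paths_to B n v"
  shows "{x \<in> cylinder B p. \<forall>i\<ge>n. x i \<in> edges (vertex_subdiagram B W) i} \<in> sets \<nu>h"
proof -
  have "0 < \<xi> v / l ^ n"
    using xi_pos[OF assms(1)] l_gt_1 by simp
  then show ?thesis
    unfolding ennreal_less_zero_iff[symmetric] extension_cylinder[OF assms, symmetric]
    by (intro emeasure_neq_0_sets) (rule less_imp_neq[symmetric])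
qed

text \<open>Additivity is used twice: over the countable set \<open>W\<close>, where it yields an
  integral, and over the finitely many paths to each \<open>v\<close>, whose pieces all have the
  same measure.\<close>

lemma
  shows tail_inside_sets: "tail_inside B W n \<in> sets \<nu>h"
    and emeasure_tail_inside:
      "emeasure \<nu>h (tail_inside B W n) =
         (\<integral>\<^sup>+v. ennreal (height B n v) * ennreal (\<xi> v / l ^ n) \<partial>count_space W)"
proof -
  let ?C = "\<lambda>p. {x \<in> cylinder B p. \<forall>i\<ge>n. x i \<in> edges (vertex_subdiagram B W) i}"
  let ?U = "\<lambda>v. \<Union>p\<in>paths_to B n v. ?C p"
  have U: "?U v \<in> sets \<nu>h" if "v \<in> W" for v
    using that by (intro sets.finite_UN finite_paths_to extension_cylinder_sets) auto
  show "tail_inside B W n \<in> sets \<nu>h"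
    unfolding tail_inside_eq_UN by (intro sets.countable_UN'' countable_W U)
  have "disjoint_family_on ?U W"
    unfolding disjoint_family_on_def
  proof (intro ballI impI, rule ccontr)
    fix v w assume "v \<noteq> w" "?U v \<inter> ?U w \<noteq> {}"
    then obtain x p q where "p \<in> paths_to B n v" "q \<in> paths_to B n w"
        "x \<in> cylinder B p" "x \<in> cylinder B q"
      by blast
    then have "v = w"
      by (intro cylinder_paths_to_eq(2))
    with \<open>v \<noteq> w\<close> show False ..
  qed
  then have "emeasure \<nu>h (tail_inside B W n) = (\<integral>\<^sup>+v. emeasure \<nu>h (?U v) \<partial>count_space W)"
    unfolding tail_inside_eq_UN using U countable_W by (intro emeasure_UN_countable)
  also have "\<dots> = (\<integral>\<^sup>+v. ennreal (height B n v) * ennreal (\<xi> v / l ^ n) \<partial>count_space W)"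
  proof (intro nn_integral_cong)
    fix v assume "v \<in> space (count_space W)"
    then have v: "v \<in> W" by simp
    have "disjoint_family_on ?C (paths_to B n v)"
      unfolding disjoint_family_on_def
    proof (intro ballI impI, rule ccontr)
      fix p q assume pq: "p \<in> paths_to B n v" "q \<in> paths_to B n v"
        and "p \<noteq> q" "?C p \<inter> ?C q \<noteq> {}"
      then obtain x where "x \<in> cylinder B p" "x \<in> cylinder B q"
        by blast
      then have "p = q"
        using pq by (rule cylinder_paths_to_eq(1))
      with \<open>p \<noteq> q\<close> show False ..
    qed
    then have "emeasure \<nu>h (?U v) = (\<Sum>p\<in>paths_to B n v. emeasure \<nu>h (?C p))"
      using extension_cylinder_sets[OF v]
      by (intro sum_emeasure[symmetric] finite_paths_to image_subsetI)
    also have "\<dots> = (\<Sum>p\<in>paths_to B n v. ennreal (\<xi> v / l ^ n))"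
      by (intro sum.cong refl extension_cylinder v)
    also have "\<dots> = ennreal (height B n v) * ennreal (\<xi> v / l ^ n)"
      by (simp add: height_def ennreal_of_nat_eq_real_of_nat)
    finally show "emeasure \<nu>h (?U v) = ennreal (height B n v) * ennreal (\<xi> v / l ^ n)" .
  qed
  finally show "emeasure \<nu>h (tail_inside B W n) = \<dots>" .
qed

lemma emeasure_extension_space:
  "emeasure \<nu>h (extension_space B W) = (SUP n. emeasure \<nu>h (tail_inside B W n))"
proof -
  have "incseq (tail_inside B W)"
    by (auto simp: incseq_def tail_inside_def)
  then show ?thesis
    unfolding extension_space_eq_UN using tail_inside_sets
    by (intro SUP_emeasure_incseq[symmetric]) auto
qed

text \<open>This is the mass of the paths that enter \<open>W\<close> from outside through their
  edge at level \<open>n\<close> and stay there afterwards. The exponent is \<open>Suc n\<close>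
  because \<open>v\<close> is a vertex of that level.\<close>

definition increment :: "nat \<Rightarrow> ennreal" where
  "increment n = (\<integral>\<^sup>+v. (\<integral>\<^sup>+w. ennreal (incidence B n v w * height B n w)
     \<partial>count_space (outer_nbrs B W n)) * ennreal (\<xi> v / l ^ Suc n) \<partial>count_space W)"

lemma emeasure_tail_inside_0: "emeasure \<nu>h (tail_inside B W 0) = 1"
proof -
  have "emeasure \<nu>h (tail_inside B W 0) = (\<integral>\<^sup>+v. ennreal (\<xi> v) \<partial>count_space W)"
    unfolding emeasure_tail_inside using W_subset_verts[of 0]
    by (intro nn_integral_cong) (auto simp: height_def paths_to_0)
  also have "\<dots> = ennreal 1"
    using xi_pos by (intro has_sum_nn_integral_count_space xi_sum less_imp_le)
  finally show ?thesis by simp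
qed

lemma emeasure_tail_inside_Suc:
  "emeasure \<nu>h (tail_inside B W (Suc n)) = emeasure \<nu>h (tail_inside B W n) + increment n"
proof -
  have nonneg: "0 \<le> \<xi> v" if "v \<in> W" for v
    using xi_pos[OF that] by simp
  have "emeasure \<nu>h (tail_inside B W (Suc n)) =
      (\<integral>\<^sup>+v. (\<integral>\<^sup>+w. ennreal (Fbar v w * height B n w) \<partial>count_space W) * ennreal (\<xi> v / l ^ Suc n)
        \<partial>count_space W) + increment n"
    unfolding emeasure_tail_inside increment_def
    by (subst nn_integral_add[symmetric])
      (auto simp: height_Suc_split distrib_right intro!: nn_integral_cong)
  also have "(\<integral>\<^sup>+v. (\<integral>\<^sup>+w. ennreal (Fbar v w * height B n w) \<partial>count_space W)
        * ennreal (\<xi> v / l ^ Suc n) \<partial>count_space W)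
      = (\<integral>\<^sup>+v. (\<integral>\<^sup>+w. ennreal (height B n w / l ^ Suc n) * ennreal (Fbar v w * \<xi> v)
          \<partial>count_space W) \<partial>count_space W)"
    using l_gt_1 nonneg
    by (intro nn_integral_cong, subst nn_integral_multc[symmetric])
      (auto intro!: nn_integral_cong simp: ennreal_mult[symmetric] mult_ac)
  \<comment> \<open>The eigenvector equation involves the transpose: it sums over the end vertex
    \<open>v\<close> for fixed \<open>w\<close>. Tonelli makes this sum the inner one.\<close>
  also have "\<dots> = (\<integral>\<^sup>+w. (\<integral>\<^sup>+v. ennreal (height B n w / l ^ Suc n) * ennreal (Fbar v w * \<xi> v)
          \<partial>count_space W) \<partial>count_space W)"
    by (rule nn_integral_count_space_nn_integral) (auto simp: countable_W)
  also have "\<dots> = (\<integral>\<^sup>+w. ennreal (height B n w) * ennreal (\<xi> w / l ^ n) \<partial>count_space W)"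
  proof (intro nn_integral_cong)
    fix w assume "w \<in> space (count_space W)"
    then have w: "w \<in> W" by simp
    have "(\<integral>\<^sup>+v. ennreal (Fbar v w * \<xi> v) \<partial>count_space W) = ennreal (l * \<xi> w)"
      using has_sum_nn_integral_count_space[OF eigenpair[OF w]] nonneg by simp
    \<comment> \<open>The eigenvalue cancels one power of \<open>l\<close>, which lowers the
      exponent from \<open>Suc n\<close> to \<open>n\<close>.\<close>
    then show "(\<integral>\<^sup>+v. ennreal (height B n w / l ^ Suc n) * ennreal (Fbar v w * \<xi> v)
          \<partial>count_space W) = ennreal (height B n w) * ennreal (\<xi> w / l ^ n)"
      using l_gt_1 nonneg[OF w] by (simp add: nn_integral_cmult ennreal_mult[symmetric])
  qed
  also have "\<dots> = emeasure \<nu>h (tail_inside B W n)"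
    by (simp add: emeasure_tail_inside)
  finally show ?thesis .
qed

lemma alpha_nonneg: "0 \<le> alpha B W n"
  unfolding alpha_def by (rule infsum_nonneg) simp

text \<open>With all incidence numbers replaced by one constant \<open>c\<close>, the inner sum no
  longer depends on \<open>v\<close> and the double sum factors. Taking \<open>c\<close> as the
  maximum or the minimum entry gives the two bounds on \<open>increment\<close>.\<close>

lemma weighted_alpha:
  fixes c :: real
  assumes "0 \<le> c"
  shows "(\<integral>\<^sup>+v. (\<integral>\<^sup>+w. ennreal (c * height B n w) \<partial>count_space (outer_nbrs B W n))
      * ennreal (\<xi> v / l ^ Suc n) \<partial>count_space W) = ennreal (alpha B W n * c / l ^ Suc n)"
proof -
  have "((\<lambda>w. c * real (height B n w)) has_sum c * alpha B W n) (outer_nbrs B W n)"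
    unfolding alpha_def using alpha_summable by (intro has_sum_cmult_right has_sum_infsum)
  then have inner: "(\<integral>\<^sup>+w. ennreal (c * height B n w) \<partial>count_space (outer_nbrs B W n))
      = ennreal (c * alpha B W n)"
    using assms by (intro has_sum_nn_integral_count_space) auto
  have "((\<lambda>v. 1 / l ^ Suc n * \<xi> v) has_sum 1 / l ^ Suc n * 1) W"
    using xi_sum by (rule has_sum_cmult_right)
  then have "(\<integral>\<^sup>+v. ennreal (1 / l ^ Suc n * \<xi> v) \<partial>count_space W) = ennreal (1 / l ^ Suc n * 1)"
    using xi_pos l_gt_1
    by (intro has_sum_nn_integral_count_space) (auto intro!: mult_nonneg_nonneg less_imp_le)
  then have "(\<integral>\<^sup>+v. ennreal (\<xi> v / l ^ Suc n) \<partial>count_space W) = ennreal (1 / l ^ Suc n)"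
    by simp
  then show ?thesis
    unfolding inner using assms alpha_nonneg l_gt_1
    by (simp add: nn_integral_cmult ennreal_mult[symmetric] mult_ac)
qed

lemma increment_le: "increment n \<le> ennreal (alpha B W n * outer_max B W n / l ^ Suc n)"
proof -
  \<comment> \<open>Boundedness makes the supremum an upper bound. Without outer neighbours there is
    nothing to compare, and the inner sums vanish.\<close>
  have le: "incidence B n v w \<le> outer_max B W n" if "v \<in> W" "w \<in> outer_nbrs B W n" for v w
    unfolding outer_max_def using that
    by (intro cSup_upper entries_bdd) (auto simp: outer_entries_def)
  have "increment n \<le> (\<integral>\<^sup>+v. (\<integral>\<^sup>+w. ennreal (real (outer_max B W n) * real (height B n w))
      \<partial>count_space (outer_nbrs B W n)) * ennreal (\<xi> v / l ^ Suc n) \<partial>count_space W)"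
    unfolding increment_def
    by (intro nn_integral_mono mult_right_mono ennreal_leI) (auto intro!: mult_right_mono le)
  also have "\<dots> = ennreal (alpha B W n * outer_max B W n / l ^ Suc n)"
    by (rule weighted_alpha) simp
  finally show ?thesis .
qed

lemma increment_ge: "ennreal (alpha B W n * outer_min B W n / l ^ Suc n) \<le> increment n"
proof -
  have le: "outer_min B W n \<le> incidence B n v w" if "v \<in> W" "w \<in> outer_nbrs B W n" for v w
    unfolding outer_min_def using that by (intro cInf_lower) (auto simp: outer_entries_def)
  have "ennreal (alpha B W n * outer_min B W n / l ^ Suc n) =
      (\<integral>\<^sup>+v. (\<integral>\<^sup>+w. ennreal (real (outer_min B W n) * real (height B n w))
      \<partial>count_space (outer_nbrs B W n)) * ennreal (\<xi> v / l ^ Suc n) \<partial>count_space W)"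
    by (rule weighted_alpha[symmetric]) simp
  also have "\<dots> \<le> increment n"
    unfolding increment_def
    by (intro nn_integral_mono mult_right_mono ennreal_leI) (auto intro!: mult_right_mono le)
  finally show ?thesis .
qed

section \<open>Comparison with geometric sequences\<close>

lemma emeasure_extension_space_finite:
  assumes "0 < \<epsilon>"
    and "\<exists>N. \<forall>n\<ge>N. alpha B W (Suc n) * real (outer_max B W (Suc n))
      < (l - \<epsilon>) * (alpha B W n * real (outer_max B W n))"
  shows "emeasure \<nu>h (extension_space B W) < \<infinity>"
proof -
  obtain N where N: "\<forall>n\<ge>N. alpha B W (Suc n) * real (outer_max B W (Suc n))
      < (l - \<epsilon>) * (alpha B W n * real (outer_max B W n))"
    using assms(2) ..
  note step = N[rule_format]
  define b where "b n = alpha B W n * outer_max B W n / l ^ Suc n" for n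
  have b_nonneg: "0 \<le> b n" for n
    using alpha_nonneg l_gt_1 by (simp add: b_def)
  have "summable b"
  proof (rule summable_ratio_test)
    \<comment> \<open>For \<epsilon> larger than \<open>l\<close> this ratio is negative; the ratio
      test asks only that it be below 1.\<close>
    show "(l - \<epsilon>) / l < 1"
      using \<open>0 < \<epsilon>\<close> l_gt_1 by simp
    fix n assume "N \<le> n"
    then have "b (Suc n) \<le> (l - \<epsilon>) * (alpha B W n * outer_max B W n) / l ^ Suc (Suc n)"
      unfolding b_def using l_gt_1 step[of n] by (intro divide_right_mono) auto
    also have "\<dots> = (l - \<epsilon>) / l * b n"
      by (simp add: b_def)
    finally show "norm (b (Suc n)) \<le> (l - \<epsilon>) / l * norm (b n)"
      using b_nonneg by simp
  qed
  \<comment> \<open>The summand 1 is the measure of the paths that lie in the subdiagram from level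
    0 on.\<close>
  have le: "emeasure \<nu>h (tail_inside B W n) \<le> ennreal (1 + (\<Sum>i<n. b i))" for n
  proof (induction n)
    case 0
    then show ?case by (simp add: emeasure_tail_inside_0)
  next
    case (Suc n)
    have "emeasure \<nu>h (tail_inside B W (Suc n)) \<le> ennreal (1 + (\<Sum>i<n. b i)) + ennreal (b n)"
      unfolding emeasure_tail_inside_Suc b_def[of n] by (intro add_mono Suc increment_le)
    also have "\<dots> = ennreal (1 + (\<Sum>i<Suc n. b i))"
      using b_nonneg by (simp add: ennreal_plus[symmetric] sum_nonneg add_ac del: ennreal_plus)
    finally show ?case .
  qed
  have "emeasure \<nu>h (tail_inside B W n) \<le> ennreal (1 + suminf b)" for n
    using sum_le_suminf[OF \<open>summable b\<close>, of "{..<n}"] b_nonneg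
    by (intro order_trans[OF le] ennreal_leI add_left_mono) simp
  then have "emeasure \<nu>h (extension_space B W) \<le> ennreal (1 + suminf b)"
    unfolding emeasure_extension_space by (intro SUP_least)
  then show ?thesis
    unfolding infinity_ennreal_def using ennreal_less_top by (rule order_le_less_trans)
qed

lemma emeasure_extension_space_infinite:
  assumes "0 < \<epsilon>"
    and "\<exists>N. \<forall>n\<ge>N. alpha B W (Suc n) * real (outer_min B W (Suc n))
      > (l + \<epsilon>) * (alpha B W n * real (outer_min B W n))"
  shows "emeasure \<nu>h (extension_space B W) = \<infinity>"
proof -
  obtain N where N: "\<forall>n\<ge>N. alpha B W (Suc n) * real (outer_min B W (Suc n))
      > (l + \<epsilon>) * (alpha B W n * real (outer_min B W n))"
    using assms(2) ..
  note step = N[rule_format]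
  define b where "b n = alpha B W n * outer_min B W n / l ^ Suc n" for n
  define q where "q = (l + \<epsilon>) / l"
  have "1 < q"
    using \<open>0 < \<epsilon>\<close> l_gt_1 by (simp add: q_def)
  have b_nonneg: "0 \<le> b n" for n
    using alpha_nonneg l_gt_1 by (simp add: b_def)
  have ratio: "q * b n < b (Suc n)" if "N \<le> n" for n
  proof -
    have "q * b n = (l + \<epsilon>) * (alpha B W n * outer_min B W n) / l ^ Suc (Suc n)"
      by (simp add: b_def q_def)
    also have "\<dots> < b (Suc n)"
      unfolding b_def using l_gt_1 step[OF that] by (intro divide_strict_right_mono) auto
    finally show ?thesis .
  qed
  \<comment> \<open>\<open>b N\<close> may be zero, but the strict inequality at \<open>N\<close>
    forces its successor to be positive. Geometric growth therefore starts at
    \<open>Suc N\<close>.\<close>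
  have pos: "0 < b (Suc N)"
    using ratio[of N] b_nonneg[of N] \<open>1 < q\<close> mult_nonneg_nonneg[of q "b N"] by linarith
  have growth: "q ^ k * b (Suc N) \<le> b (Suc N + k)" for k
  proof (induction k)
    case (Suc k)
    have "q ^ Suc k * b (Suc N) \<le> q * b (Suc N + k)"
      using Suc \<open>1 < q\<close> by (simp add: mult.assoc)
    also have "\<dots> \<le> b (Suc N + Suc k)"
      using ratio[of "Suc N + k"] by simp
    finally show ?case .
  qed simp
  \<comment> \<open>A single increment already bounds the total mass from below, so unbounded terms
    suffice and no series has to be summed.\<close>
  have ge: "ennreal (b n) \<le> emeasure \<nu>h (extension_space B W)" for n
  proof -
    have "ennreal (b n) \<le> emeasure \<nu>h (tail_inside B W (Suc n))"
      unfolding emeasure_tail_inside_Suc b_def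
      using increment_ge by (rule order_trans) simp
    also have "\<dots> \<le> emeasure \<nu>h (extension_space B W)"
      unfolding emeasure_extension_space by (rule SUP_upper) simp
    finally show ?thesis .
  qed
  show ?thesis
  proof (rule ccontr)
    assume "emeasure \<nu>h (extension_space B W) \<noteq> \<infinity>"
    then obtain r where r: "0 \<le> r" "emeasure \<nu>h (extension_space B W) = ennreal r"
      by (cases "emeasure \<nu>h (extension_space B W)") auto
    obtain k where "r / b (Suc N) < q ^ k"
      using real_arch_pow[OF \<open>1 < q\<close>] by blast
    then have "r < b (Suc N + k)"
      using growth[of k] pos by (simp add: field_simps)
    then show False
      using ge[of "Suc N + k"] r by (simp add: ennreal_le_iff)
  qed
qed

end

section \<open>The finiteness and infinity criteria\<close>

theorem proposition4p10:
  fixes B :: "('v, 'e) graded_graph" and W :: "'v set" and Fbar :: "'v \<Rightarrow> 'v \<Rightarrow> nat"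
    and l :: real and \<xi> :: "'v \<Rightarrow> real" and \<nu> \<nu>h :: "(nat \<Rightarrow> 'e) measure"
  assumes sub: "stationary_vertex_subdiagram B W Fbar"
    and l_gt_1: "1 < l"
    and xi_pos: "\<forall>v \<in> W. 0 < \<xi> v"
    and xi_sum: "(\<xi> has_sum 1) W"
    and eigenpair: "\<forall>w \<in> W. ((\<lambda>v. real (Fbar v w) * \<xi> v) has_sum l * \<xi> w) W"
    and nu_prob: "prob_space \<nu>"
    and nu_inv: "tail_invariant_measure (vertex_subdiagram B W) (path_space (vertex_subdiagram B W)) \<nu>"
    and nu_cyl: "\<forall>n. \<forall>v \<in> W. \<forall>p \<in> paths_to (vertex_subdiagram B W) n v.
                   emeasure \<nu> (cylinder (vertex_subdiagram B W) p) = ennreal (\<xi> v / l ^ n)"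
    and nuh: "measure_extension B W l \<xi> \<nu> \<nu>h"
    and alpha_finite: "\<forall>n. (\<lambda>w. real (height B n w)) summable_on outer_nbrs B W n"
    and M_finite: "\<forall>n. bdd_above (outer_entries B W n)"
  shows
    "((\<forall>\<epsilon>>0. \<exists>N. \<forall>n\<ge>N. alpha B W (Suc n) * real (outer_max B W (Suc n))
                            < (l - \<epsilon>) * (alpha B W n * real (outer_max B W n)))
        \<longrightarrow> emeasure \<nu>h (extension_space B W) < \<infinity>)
     \<and> ((\<forall>\<epsilon>>0. \<exists>N. \<forall>n\<ge>N. alpha B W (Suc n) * real (outer_min B W (Suc n))
                            > (l + \<epsilon>) * (alpha B W n * real (outer_min B W n)))
        \<longrightarrow> emeasure \<nu>h (extension_space B W) = \<infinity>)
     \<and> ((\<exists>\<epsilon>>0. \<exists>N. \<forall>n\<ge>N. alpha B W (Suc n) * real (outer_max B W (Suc n))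
                            < (l - \<epsilon>) * (alpha B W n * real (outer_max B W n)))
        \<longrightarrow> emeasure \<nu>h (extension_space B W) < \<infinity>)
     \<and> ((\<exists>\<epsilon>>0. \<exists>N. \<forall>n\<ge>N. alpha B W (Suc n) * real (outer_min B W (Suc n))
                            > (l + \<epsilon>) * (alpha B W n * real (outer_min B W n)))
        \<longrightarrow> emeasure \<nu>h (extension_space B W) = \<infinity>)"
proof -
  interpret stationary_vertex_subdiagram B W Fbar
    by (rule sub)
  interpret eigen_extension B W Fbar l \<xi> \<nu>h
  proof
    show "emeasure \<nu>h {x \<in> cylinder B p. \<forall>i\<ge>n. x i \<in> edges (vertex_subdiagram B W) i}
        = ennreal (\<xi> v / l ^ n)" if "v \<in> W" "p \<in> paths_to B n v" for v p n
      using nuh that unfolding measure_extension_def by blast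
    show "0 < \<xi> v" if "v \<in> W" for v
      using xi_pos that ..
    show "((\<lambda>v. real (Fbar v w) * \<xi> v) has_sum l * \<xi> w) W" if "w \<in> W" for w
      using eigenpair that ..
    show "(\<lambda>w. real (height B n w)) summable_on outer_nbrs B W n" for n
      using alpha_finite ..
    show "bdd_above (outer_entries B W n)" for n
      using M_finite ..
  qed (fact l_gt_1 xi_sum)+
  let ?max = "\<lambda>\<epsilon>. \<exists>N. \<forall>n\<ge>N. alpha B W (Suc n) * real (outer_max B W (Suc n))
    < (l - \<epsilon>) * (alpha B W n * real (outer_max B W n))"
  let ?min = "\<lambda>\<epsilon>. \<exists>N. \<forall>n\<ge>N. alpha B W (Suc n) * real (outer_min B W (Suc n))
    > (l + \<epsilon>) * (alpha B W n * real (outer_min B W n))"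
  show ?thesis
  proof (intro conjI impI)
    assume "\<forall>\<epsilon>>0. ?max \<epsilon>"
    \<comment> \<open>\<open>zero_less_one\<close> selects the instance \<epsilon> = 1 of the
      universally quantified condition; the next case does the same.\<close>
    then show "emeasure \<nu>h (extension_space B W) < \<infinity>"
      by (intro emeasure_extension_space_finite[OF zero_less_one]) simp
  next
    assume "\<forall>\<epsilon>>0. ?min \<epsilon>"
    then show "emeasure \<nu>h (extension_space B W) = \<infinity>"
      by (intro emeasure_extension_space_infinite[OF zero_less_one]) simp
  next
    assume "\<exists>\<epsilon>>0. ?max \<epsilon>"
    then show "emeasure \<nu>h (extension_space B W) < \<infinity>"
      by - (erule exE, erule conjE, rule emeasure_extension_space_finite)
  next
    assume "\<exists>\<epsilon>>0. ?min \<epsilon>"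
    then show "emeasure \<nu>h (extension_space B W) = \<infinity>"
      by - (erule exE, erule conjE, rule emeasure_extension_space_infinite)
  qed
qed

end
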